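(* Let $\xi=(\xi_1,\xi_2)=(\mu,\mu^2+\sigma^2)$ be the dual coordinate system associated with the natural coordinates $\theta=(\mu,\sigma)\in\mathbb{R}\times(0,\infty)$ on the Gaussian statistical manifold. Then the Riemannian (Fisher information) metric $G_d=(g_{\alpha\beta}(\xi))_{1\le\alpha,\beta\le2}$ in the $\xi$-coordinate system is given by $$G_d=\frac{1}{\sigma^4}\begin{pmatrix}\sigma^2+2\mu^2&-\mu\\-\mu&\frac12\end{pmatrix}.$$ The determinant of this metric tensor is $$\det G_d=\frac{1}{2\sigma^6},$$ and the inverse of the Fisher information matrix in the $\xi$-coordinate system is $$G_d^{-1}=\begin{pmatrix}\sigma^2&2\mu\sigma^2\\2\mu\sigma^2&2\sigma^4+4\mu^2\sigma^2\end{pmatrix}.$$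
   Context: The Gaussian statistical manifold is $S=\{p_\theta(x)=\frac{1}{\sqrt{2\pi}\,\sigma}e^{-(x-\mu)^2/(2\sigma^2)} : \theta=(\mu,\sigma)\in\mathbb{R}\times(0,\infty)\}$, $x\in\mathbb{R}$, with $l(x,\theta)=\log p_\theta(x)$. Its Riemannian metric is the Fisher information metric $g_{ij}(\theta)=\langle\partial_i,\partial_j\rangle=\mathbb{E}[\partial_i l\,\partial_j l]$, where $\partial_1=\frac{\partial}{\partial\mu}$, $\partial_2=\frac{\partial}{\partial\sigma}$ and the expectation is with respect to $p_\theta$. The components in the $\xi$-coordinate system are $g_{\alpha\beta}(\xi)=\langle\partial_{\xi_\alpha},\partial_{\xi_\beta}\rangle$, where $\partial_{\xi_\alpha}=\frac{\partial}{\partial\xi_\alpha}=\sum_{i=1}^2\frac{\partial\theta_i}{\partial\xi_\alpha}\partial_i$ and $(\theta_1,\theta_2)=(\mu,\sigma)$. *)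

theory Defs
  imports "HOL-Probability.Probability"
begin

text \<open>A point of the Gaussian manifold is represented by its natural coordinates
  \<open>\<theta> = (\<mu>, \<sigma>)\<close>, a vector in the open half plane below.\<close>

definition Theta :: "(real^2) set" where
  "Theta = {\<theta>. \<theta> $ 2 > 0}"

definition gauss_density :: "real^2 \<Rightarrow> real \<Rightarrow> real" where
  "gauss_density \<theta> x = normal_density (\<theta> $ 1) (\<theta> $ 2) x"

definition gauss_measure :: "real^2 \<Rightarrow> real measure" where
  "gauss_measure \<theta> = density lborel (gauss_density \<theta>)"

definition log_lik :: "real \<Rightarrow> real^2 \<Rightarrow> real" where
  "log_lik x \<theta> = ln (gauss_density \<theta> x)"

definition partial :: "'n::finite \<Rightarrow> (real^'n \<Rightarrow> real) \<Rightarrow> real^'n \<Rightarrow> real" where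
  "partial i f a = deriv (\<lambda>t. f (a + t *\<^sub>R axis i 1)) 0"

definition fisher :: "real^2 \<Rightarrow> real^2^2" where
  "fisher \<theta> = (\<chi> i j. integral\<^sup>L (gauss_measure \<theta>)
      (\<lambda>x. partial i (log_lik x) \<theta> * partial j (log_lik x) \<theta>))"

text \<open>The metric on tangent vectors at \<open>\<theta>\<close>, given by their components with respect to the
  basis \<open>\<partial>/\<partial>\<mu>, \<partial>/\<partial>\<sigma>\<close>.\<close>

definition fisher_metric :: "real^2 \<Rightarrow> real^2 \<Rightarrow> real^2 \<Rightarrow> real" where
  "fisher_metric \<theta> u v = (\<Sum>i\<in>UNIV. \<Sum>j\<in>UNIV. u $ i * v $ j * fisher \<theta> $ i $ j)"

definition dual_coord :: "real^2 \<Rightarrow> real^2" where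
  "dual_coord \<theta> = vector [\<theta> $ 1, (\<theta> $ 1)\<^sup>2 + (\<theta> $ 2)\<^sup>2]"

definition natural_coord :: "real^2 \<Rightarrow> real^2" where
  "natural_coord = inv_into Theta dual_coord"

text \<open>Components, in the basis \<open>\<partial>/\<partial>\<mu>, \<partial>/\<partial>\<sigma>\<close>, of the coordinate vector field of \<open>\<xi>\<^sub>\<alpha>\<close> at
  the point with dual coordinates \<open>\<xi>\<close>.\<close>

definition dual_basis_vector :: "2 \<Rightarrow> real^2 \<Rightarrow> real^2" where
  "dual_basis_vector \<alpha> \<xi> = (\<chi> i. partial \<alpha> (\<lambda>\<eta>. natural_coord \<eta> $ i) \<xi>)"

definition dual_fisher :: "real^2 \<Rightarrow> real^2^2" where
  "dual_fisher \<xi> = (\<chi> \<alpha> \<beta>. fisher_metric (natural_coord \<xi>)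
      (dual_basis_vector \<alpha> \<xi>) (dual_basis_vector \<beta> \<xi>))"

text \<open>Since \<open>deriv\<close>, \<open>integral\<^sup>L\<close> and \<open>inv_into\<close> are total functions, the following lemmas
  record that they are applied only where they are meaningful.\<close>

lemma gauss_density_eq:
  assumes "\<theta> \<in> Theta"
  shows "gauss_density \<theta> x =
    1 / (sqrt (2 * pi) * \<theta> $ 2) * exp (- (x - \<theta> $ 1)\<^sup>2 / (2 * (\<theta> $ 2)\<^sup>2))"
  using assms by (simp add: gauss_density_def normal_density_def Theta_def real_sqrt_mult)

lemma inj_on_dual_coord: "inj_on dual_coord Theta"
proof (rule inj_onI)
  fix a b :: "real^2"
  assume "a \<in> Theta" "b \<in> Theta" and e: "dual_coord a = dual_coord b"
  then have p: "a $ 2 > 0" "b $ 2 > 0" by (auto simp: Theta_def)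
  have "dual_coord a $ 1 = dual_coord b $ 1" "dual_coord a $ 2 = dual_coord b $ 2"
    using e by simp_all
  then have "a $ 1 = b $ 1" "(a $ 2)\<^sup>2 = (b $ 2)\<^sup>2"
    by (simp_all add: dual_coord_def)
  with p show "a = b" by (simp add: vec_eq_iff forall_2)
qed

lemma dual_coord_image: "dual_coord ` Theta = {\<xi>. \<xi> $ 2 > (\<xi> $ 1)\<^sup>2}"
proof (intro equalityI subsetI)
  fix \<xi> :: "real^2" assume "\<xi> \<in> {\<xi>. \<xi> $ 2 > (\<xi> $ 1)\<^sup>2}"
  then have "vector [\<xi> $ 1, sqrt (\<xi> $ 2 - (\<xi> $ 1)\<^sup>2)] \<in> Theta"
      "dual_coord (vector [\<xi> $ 1, sqrt (\<xi> $ 2 - (\<xi> $ 1)\<^sup>2)]) = \<xi>"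
    by (auto simp: Theta_def dual_coord_def vec_eq_iff forall_2)
  then show "\<xi> \<in> dual_coord ` Theta" by (metis imageI)
qed (auto simp: Theta_def dual_coord_def)

lemma natural_coord_eq:
  assumes "\<xi> $ 2 > (\<xi> $ 1)\<^sup>2"
  shows "natural_coord \<xi> = vector [\<xi> $ 1, sqrt (\<xi> $ 2 - (\<xi> $ 1)\<^sup>2)]"
proof -
  have "vector [\<xi> $ 1, sqrt (\<xi> $ 2 - (\<xi> $ 1)\<^sup>2)] \<in> Theta"
      "dual_coord (vector [\<xi> $ 1, sqrt (\<xi> $ 2 - (\<xi> $ 1)\<^sup>2)]) = \<xi>"
    using assms by (auto simp: Theta_def dual_coord_def vec_eq_iff forall_2)
  then show ?thesis
    unfolding natural_coord_def by (metis inv_into_f_f inj_on_dual_coord)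
qed

lemma log_lik_eq:
  assumes "\<theta> \<in> Theta"
  shows "log_lik x \<theta> = - ln (sqrt (2 * pi)) - ln (\<theta> $ 2) - (x - \<theta> $ 1)\<^sup>2 / (2 * (\<theta> $ 2)\<^sup>2)"
  using assms unfolding log_lik_def gauss_density_eq[OF assms]
  by (simp add: Theta_def ln_mult ln_div)

lemma score:
  assumes "\<theta> \<in> Theta"
  shows score_1: "((\<lambda>t. log_lik x (\<theta> + t *\<^sub>R axis 1 1)) has_real_derivative
      (x - \<theta> $ 1) / (\<theta> $ 2)\<^sup>2) (at 0)"
    and score_2: "((\<lambda>t. log_lik x (\<theta> + t *\<^sub>R axis 2 1)) has_real_derivative
      (x - \<theta> $ 1)\<^sup>2 / (\<theta> $ 2) ^ 3 - 1 / \<theta> $ 2) (at 0)"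
proof -
  have p: "\<theta> $ 2 > 0" using assms by (simp add: Theta_def)
  have "((\<lambda>t. - ln (sqrt (2 * pi)) - ln (\<theta> $ 2) - (x - (\<theta> $ 1 + t))\<^sup>2 / (2 * (\<theta> $ 2)\<^sup>2))
      has_real_derivative (x - \<theta> $ 1) / (\<theta> $ 2)\<^sup>2) (at 0)"
    using p by (auto intro!: derivative_eq_intros simp: field_simps)
  moreover have "\<theta> + t *\<^sub>R axis 1 1 \<in> Theta" for t
    using p by (simp add: Theta_def axis_def)
  ultimately show "((\<lambda>t. log_lik x (\<theta> + t *\<^sub>R axis 1 1)) has_real_derivative
      (x - \<theta> $ 1) / (\<theta> $ 2)\<^sup>2) (at 0)"
    by (simp add: log_lik_eq axis_def)
  have d: "((\<lambda>t. - ln (sqrt (2 * pi)) - ln (\<theta> $ 2 + t) - (x - \<theta> $ 1)\<^sup>2 / (2 * (\<theta> $ 2 + t)\<^sup>2))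
      has_real_derivative (x - \<theta> $ 1)\<^sup>2 / (\<theta> $ 2) ^ 3 - 1 / \<theta> $ 2) (at 0)"
    using p by (auto intro!: derivative_eq_intros)
      (simp add: eval_nat_numeral field_simps)
  have "\<forall>\<^sub>F t in nhds 0. t \<in> {- \<theta> $ 2<..}"
    using p by (intro eventually_nhds_in_open) auto
  then have ev: "\<forall>\<^sub>F t in nhds 0. log_lik x (\<theta> + t *\<^sub>R axis 2 1) =
      - ln (sqrt (2 * pi)) - ln (\<theta> $ 2 + t) - (x - \<theta> $ 1)\<^sup>2 / (2 * (\<theta> $ 2 + t)\<^sup>2)"
    by eventually_elim (subst log_lik_eq, auto simp: Theta_def axis_def)
  show "((\<lambda>t. log_lik x (\<theta> + t *\<^sub>R axis 2 1)) has_real_derivative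
      (x - \<theta> $ 1)\<^sup>2 / (\<theta> $ 2) ^ 3 - 1 / \<theta> $ 2) (at 0)"
    using d DERIV_cong_ev[OF refl ev refl] by blast
qed

lemma partial_log_lik:
  assumes "\<theta> \<in> Theta"
  shows "partial 1 (log_lik x) \<theta> = (x - \<theta> $ 1) / (\<theta> $ 2)\<^sup>2"
    and "partial 2 (log_lik x) \<theta> = (x - \<theta> $ 1)\<^sup>2 / (\<theta> $ 2) ^ 3 - 1 / \<theta> $ 2"
  unfolding partial_def using score[OF assms] by (auto intro: DERIV_imp_deriv)

lemma integrable_fisher:
  assumes "\<theta> \<in> Theta"
  shows "integrable (gauss_measure \<theta>)
    (\<lambda>x. partial i (log_lik x) \<theta> * partial j (log_lik x) \<theta>)"
proof -
  define m s where "m = \<theta> $ 1" and "s = \<theta> $ 2"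
  have p: "s > 0" using assms by (simp add: Theta_def s_def)
  have I: "integrable lborel (\<lambda>x. normal_density m s x * (x - m) ^ k)" for k
    using integrable_normal_moment[OF p] by simp
  have M: "integrable (gauss_measure \<theta>) (\<lambda>x. (x - m) ^ k)" for k
    unfolding gauss_measure_def gauss_density_def m_def[symmetric] s_def[symmetric]
    using I p by (subst integrable_real_density) auto
  have "integrable (gauss_measure \<theta>) (\<lambda>x. (x - m) ^ 2 / s ^ 4)"
    "integrable (gauss_measure \<theta>) (\<lambda>x. (x - m) ^ 3 / s ^ 5 - (x - m) ^ 1 / s ^ 3)"
    "integrable (gauss_measure \<theta>) (\<lambda>x. (x - m) ^ 4 / s ^ 6 - 2 * ((x - m) ^ 2 / s ^ 4) + (x - m) ^ 0 / s ^ 2)"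
    by (intro M Bochner_Integration.integrable_diff Bochner_Integration.integrable_add
        integrable_divide integrable_mult_right)+
  moreover have "(x - m) / s\<^sup>2 * ((x - m) / s\<^sup>2) = (x - m) ^ 2 / s ^ 4"
    "(x - m) / s\<^sup>2 * ((x - m)\<^sup>2 / s ^ 3 - 1 / s) = (x - m) ^ 3 / s ^ 5 - (x - m) ^ 1 / s ^ 3"
    "((x - m)\<^sup>2 / s ^ 3 - 1 / s) * ((x - m) / s\<^sup>2) = (x - m) ^ 3 / s ^ 5 - (x - m) ^ 1 / s ^ 3"
    "((x - m)\<^sup>2 / s ^ 3 - 1 / s) * ((x - m)\<^sup>2 / s ^ 3 - 1 / s) =
       (x - m) ^ 4 / s ^ 6 - 2 * ((x - m) ^ 2 / s ^ 4) + (x - m) ^ 0 / s ^ 2" for x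
    using p by (simp_all add: divide_simps) (simp_all add: eval_nat_numeral algebra_simps)
  ultimately show ?thesis
    using exhaust_2[of i] exhaust_2[of j]
    by (elim disjE) (simp_all only: partial_log_lik[OF assms] m_def[symmetric] s_def[symmetric])
qed

lemma natural_coord_differentiable:
  fixes \<xi> :: "real^2"
  assumes "\<xi> \<in> dual_coord ` Theta"
  shows "(\<lambda>t. natural_coord (\<xi> + t *\<^sub>R axis \<alpha> 1) $ i) field_differentiable (at 0)"
proof -
  let ?f = "\<lambda>t::real. (\<xi> + t *\<^sub>R axis \<alpha> 1 :: real^2)"
  let ?g = "\<lambda>t. ?f t $ 2 - (?f t $ 1)\<^sup>2"
  let ?h = "\<lambda>t. if i = 1 then ?f t $ 1 else sqrt (?g t)"
  have p: "\<xi> $ 2 > (\<xi> $ 1)\<^sup>2" using assms by (simp add: dual_coord_image)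
  have "open {t. ?g t > 0}"
    by (intro open_Collect_less continuous_intros)
  then have "\<forall>\<^sub>F t in nhds 0. t \<in> {t. ?g t > 0}"
    using p by (intro eventually_nhds_in_open) auto
  then have ev: "\<forall>\<^sub>F t in nhds 0. natural_coord (?f t) $ i = ?h t"
    by eventually_elim (use exhaust_2[of i] in \<open>auto simp: natural_coord_eq\<close>)
  have c: "((\<lambda>t. ?f t $ k) has_real_derivative (axis \<alpha> 1 :: real^2) $ k) (at 0)" for k
    by (auto intro!: derivative_eq_intros)
  have g: "(?g has_real_derivative axis \<alpha> 1 $ 2 - 2 * \<xi> $ 1 * axis \<alpha> 1 $ 1) (at 0)"
    by (auto intro!: derivative_eq_intros)
  have "\<exists>D. (?h has_real_derivative D) (at 0)"
  proof (cases "i = 1")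
    case False
    have "((\<lambda>t. sqrt (?g t)) has_real_derivative
       inverse (sqrt (?g 0)) / 2 * (axis \<alpha> 1 $ 2 - 2 * \<xi> $ 1 * axis \<alpha> 1 $ 1)) (at 0)"
      by (rule DERIV_chain2[OF DERIV_real_sqrt g]) (use p in simp)
    then show ?thesis using False by auto
  qed (use c[of 1] in auto)
  then show ?thesis
    unfolding field_differentiable_def using DERIV_cong_ev[OF refl ev refl] by blast
qed

end

theory Submission
  imports Defs
begin

text \<open>In the coordinates \<open>(\<mu>, \<sigma>)\<close> the score functions are polynomials in \<open>x - \<mu>\<close>, so the Gaussian
  central moments give the Fisher matrix \<open>diag (1/\<sigma>\<^sup>2, 2/\<sigma>\<^sup>2)\<close>.  Differentiating
  \<open>\<sigma> = sqrt (\<xi>\<^sub>2 - \<xi>\<^sub>1\<^sup>2)\<close> gives \<open>\<partial>/\<partial>\<xi>\<^sub>1 = (1, -\<mu>/\<sigma>)\<close> and \<open>\<partial>/\<partial>\<xi>\<^sub>2 = (0, 1/(2\<sigma>))\<close>, and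
  the components of the metric follow by bilinearity.\<close>

text \<open>Odd central moments vanish by symmetry. For \<open>k = 2 * j\<close> the value is
  (2j)!/j! * (s^2/2)^j, so the moments of order 0, 2, 4 are 1, s^2 and 3 s^4.\<close>

lemma integral_normal_moment:
  assumes "s > 0"
  shows "integral\<^sup>L (density lborel (normal_density m s)) (\<lambda>x. (x - m) ^ k) =
    (if even k then fact k / ((2 / s\<^sup>2) ^ (k div 2) * fact (k div 2)) else 0)"
proof -
  have "integral\<^sup>L (density lborel (normal_density m s)) (\<lambda>x. (x - m) ^ k) =
      integral\<^sup>L lborel (\<lambda>x. normal_density m s x * (x - m) ^ k)"
    using assms by (subst integral_density) auto
  also have "\<dots> = (if even k then fact k / ((2 / s\<^sup>2) ^ (k div 2) * fact (k div 2)) else 0)"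
  proof (cases "even k")
    case True
    then obtain j where k: "k = 2 * j" by blast
    then show ?thesis
      using has_bochner_integral_integral_eq[OF normal_moment_even[OF assms, of m j]] by simp
  next
    case False
    then obtain j where k: "k = 2 * j + 1" by (blast elim: oddE)
    then show ?thesis
      using has_bochner_integral_integral_eq[OF normal_moment_odd[OF assms, of m j]] by simp
  qed
  finally show ?thesis .
qed

lemma integrable_normal_moment_density:
  assumes "s > 0"
  shows "integrable (density lborel (normal_density m s)) (\<lambda>x. (x - m) ^ k)"
  using integrable_normal_moment[OF assms, of m k] assms
  by (subst integrable_real_density) auto

text \<open>The off-diagonal entries involve only odd moments. The diagonal ones are s^2/s^4 = 1/s^2
  and 3/s^2 - 2/s^2 + 1/s^2 = 2/s^2.\<close>

lemma fisher_eq: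
  assumes "\<theta> \<in> Theta"
  shows "fisher \<theta> = (1 / (\<theta> $ 2)\<^sup>2) *\<^sub>R vector [vector [1, 0], vector [0, 2]]"
proof -
  define m s where "m = \<theta> $ 1" and "s = \<theta> $ 2"
  have p: "s > 0" using assms by (simp add: Theta_def s_def)
  define N where "N = density lborel (normal_density m s)"
  have N: "gauss_measure \<theta> = N"
    by (simp add: N_def gauss_measure_def gauss_density_def[abs_def] m_def s_def)
  have I: "integrable N (\<lambda>x. (x - m) ^ k)" for k
    unfolding N_def by (rule integrable_normal_moment_density[OF p])
  note sums = Bochner_Integration.integral_diff Bochner_Integration.integral_add
    Bochner_Integration.integrable_diff Bochner_Integration.integrable_add
    integrable_divide integrable_mult_right I
  note E = integral_normal_moment[OF p, of m, folded N_def]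
  \<comment> \<open>The exponents 1 and 0 are written out so that every term is a central moment to
    which \<open>I\<close> and \<open>E\<close> apply.\<close>
  have e11: "(x - m) / s\<^sup>2 * ((x - m) / s\<^sup>2) = (x - m) ^ 2 / s ^ 4"
    and e12: "(x - m) / s\<^sup>2 * ((x - m)\<^sup>2 / s ^ 3 - 1 / s) = (x - m) ^ 3 / s ^ 5 - (x - m) ^ 1 / s ^ 3"
    and e22: "((x - m)\<^sup>2 / s ^ 3 - 1 / s) * ((x - m)\<^sup>2 / s ^ 3 - 1 / s) =
       (x - m) ^ 4 / s ^ 6 - 2 * ((x - m) ^ 2 / s ^ 4) + (x - m) ^ 0 / s ^ 2" for x
    using p by (simp_all add: divide_simps) (simp_all add: eval_nat_numeral algebra_simps)
  have i11: "integral\<^sup>L N (\<lambda>x. (x - m) / s\<^sup>2 * ((x - m) / s\<^sup>2)) = 1 / s\<^sup>2"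
    unfolding e11 using p by (simp add: E) (simp add: eval_nat_numeral field_simps)
  have i12: "integral\<^sup>L N (\<lambda>x. (x - m) / s\<^sup>2 * ((x - m)\<^sup>2 / s ^ 3 - 1 / s)) = 0"
  proof -
    have "integral\<^sup>L N (\<lambda>x. (x - m) ^ 3 / s ^ 5 - (x - m) ^ 1 / s ^ 3) =
        integral\<^sup>L N (\<lambda>x. (x - m) ^ 3) / s ^ 5 - integral\<^sup>L N (\<lambda>x. (x - m) ^ 1) / s ^ 3"
      by (subst Bochner_Integration.integral_diff, (intro sums)+) simp
    then show ?thesis unfolding e12 unfolding E by simp
  qed
  have i22: "integral\<^sup>L N (\<lambda>x. ((x - m)\<^sup>2 / s ^ 3 - 1 / s) * ((x - m)\<^sup>2 / s ^ 3 - 1 / s)) = 2 / s\<^sup>2"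
  proof -
    have "integral\<^sup>L N (\<lambda>x. (x - m) ^ 4 / s ^ 6 - 2 * ((x - m) ^ 2 / s ^ 4) + (x - m) ^ 0 / s ^ 2) =
        integral\<^sup>L N (\<lambda>x. (x - m) ^ 4) / s ^ 6 - 2 * (integral\<^sup>L N (\<lambda>x. (x - m) ^ 2) / s ^ 4)
          + integral\<^sup>L N (\<lambda>x. (x - m) ^ 0) / s ^ 2"
      by (subst Bochner_Integration.integral_add, (intro sums)+,
          subst Bochner_Integration.integral_diff, (intro sums)+) simp
    also have "\<dots> = 2 / s\<^sup>2"
      unfolding E using p by (simp add: fact_numeral) (simp add: eval_nat_numeral field_simps)
    finally show ?thesis unfolding e22 .
  qed
  have i21: "integral\<^sup>L N (\<lambda>x. ((x - m)\<^sup>2 / s ^ 3 - 1 / s) * ((x - m) / s\<^sup>2)) = 0"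
    using i12 by (simp only: mult.commute)
  \<comment> \<open>The deleted simp rules would rewrite the score products out of the shape in
    which \<open>i11\<close> to \<open>i22\<close> state them.\<close>
  show ?thesis
    unfolding vec_eq_iff forall_2 fisher_def N
    by (simp add: partial_log_lik[OF assms] m_def[symmetric] s_def[symmetric] i11 i12 i21 i22
        del: times_divide_eq_left times_divide_eq_right)
qed

lemma dual_basis_vector_eq:
  fixes \<xi> :: "real^2"
  assumes "\<xi> $ 2 > (\<xi> $ 1)\<^sup>2"
  shows "dual_basis_vector 1 \<xi> = vector [1, - \<xi> $ 1 / sqrt (\<xi> $ 2 - (\<xi> $ 1)\<^sup>2)]"
    and "dual_basis_vector 2 \<xi> = vector [0, 1 / (2 * sqrt (\<xi> $ 2 - (\<xi> $ 1)\<^sup>2))]"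
proof -
  \<comment> \<open>Both directions are treated at once: \<open>axis \<alpha> 1 $ k\<close> is the
    Kronecker delta of \<alpha> and k.\<close>
  have D: "partial \<alpha> (\<lambda>\<eta>. natural_coord \<eta> $ 1) \<xi> = axis \<alpha> 1 $ 1"
    "partial \<alpha> (\<lambda>\<eta>. natural_coord \<eta> $ 2) \<xi> =
      (axis \<alpha> 1 $ 2 - 2 * \<xi> $ 1 * axis \<alpha> 1 $ 1) / (2 * sqrt (\<xi> $ 2 - (\<xi> $ 1)\<^sup>2))" for \<alpha> :: 2
  proof -
    let ?f = "\<lambda>t::real. (\<xi> + t *\<^sub>R axis \<alpha> 1 :: real^2)"
    let ?g = "\<lambda>t. ?f t $ 2 - (?f t $ 1)\<^sup>2"
    \<comment> \<open>The closed form of \<open>natural_coord\<close> is available only above the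
      parabola. This region is open, so the form holds for t near 0, which is enough to determine
      \<open>deriv\<close>.\<close>
    have "open {t. ?g t > 0}"
      by (intro open_Collect_less continuous_intros)
    then have "\<forall>\<^sub>F t in nhds 0. t \<in> {t. ?g t > 0}"
      using assms by (intro eventually_nhds_in_open) auto
    then have ev: "\<forall>\<^sub>F t in nhds 0. natural_coord (?f t) = vector [?f t $ 1, sqrt (?g t)]"
      by eventually_elim (simp add: natural_coord_eq)
    have ev1: "\<forall>\<^sub>F t in nhds 0. natural_coord (?f t) $ 1 = ?f t $ 1"
      and ev2: "\<forall>\<^sub>F t in nhds 0. natural_coord (?f t) $ 2 = sqrt (?g t)"
      using ev by (eventually_elim, simp)+
    have g: "(?g has_real_derivative axis \<alpha> 1 $ 2 - 2 * \<xi> $ 1 * axis \<alpha> 1 $ 1) (at 0)"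
      by (auto intro!: derivative_eq_intros)
    have "((\<lambda>t. sqrt (?g t)) has_real_derivative
       inverse (sqrt (?g 0)) / 2 * (axis \<alpha> 1 $ 2 - 2 * \<xi> $ 1 * axis \<alpha> 1 $ 1)) (at 0)"
      by (rule DERIV_chain2[OF DERIV_real_sqrt g]) (use assms in simp)
    then show "partial \<alpha> (\<lambda>\<eta>. natural_coord \<eta> $ 2) \<xi> =
      (axis \<alpha> 1 $ 2 - 2 * \<xi> $ 1 * axis \<alpha> 1 $ 1) / (2 * sqrt (\<xi> $ 2 - (\<xi> $ 1)\<^sup>2))"
      unfolding partial_def deriv_cong_ev[OF ev2 refl]
      by (auto dest!: DERIV_imp_deriv simp: field_simps)
    have "((\<lambda>t. ?f t $ 1) has_real_derivative axis \<alpha> 1 $ 1) (at 0)"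
      by (auto intro!: derivative_eq_intros)
    then show "partial \<alpha> (\<lambda>\<eta>. natural_coord \<eta> $ 1) \<xi> = axis \<alpha> 1 $ 1"
      unfolding partial_def deriv_cong_ev[OF ev1 refl] by (rule DERIV_imp_deriv)
  qed
  show "dual_basis_vector 1 \<xi> = vector [1, - \<xi> $ 1 / sqrt (\<xi> $ 2 - (\<xi> $ 1)\<^sup>2)]"
    "dual_basis_vector 2 \<xi> = vector [0, 1 / (2 * sqrt (\<xi> $ 2 - (\<xi> $ 1)\<^sup>2))]"
    by (simp_all add: dual_basis_vector_def vec_eq_iff forall_2 D axis_def)
qed

text \<open>Over a field a right inverse of a square matrix is two-sided, so the choice in
  \<open>matrix_inv\<close> has a witness, and two-sided inverses coincide.\<close>

lemma matrix_inv_unique: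
  fixes A B :: "'a::field^'n^'n"
  assumes "A ** B = mat 1"
  shows "matrix_inv A = B"
proof -
  have "B ** A = mat 1" using assms matrix_left_right_inverse by blast
  with assms have "\<exists>A'. A ** A' = mat 1 \<and> A' ** A = mat 1" by blast
  then have "A ** matrix_inv A = mat 1 \<and> matrix_inv A ** A = mat 1"
    unfolding matrix_inv_def by (rule someI_ex)
  then show ?thesis
    by (metis assms matrix_mul_assoc matrix_mul_lid matrix_mul_rid)
qed

theorem theorem3:
  fixes \<mu> \<sigma> :: real and \<xi> :: "real^2"
  assumes "\<sigma> > 0"
    and "\<xi> = dual_coord (vector [\<mu>, \<sigma>])"
  shows "dual_fisher \<xi> = (1 / \<sigma> ^ 4) *\<^sub>R vector [vector [\<sigma>\<^sup>2 + 2 * \<mu>\<^sup>2, - \<mu>], vector [- \<mu>, 1 / 2]] \<and>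
    det (dual_fisher \<xi>) = 1 / (2 * \<sigma> ^ 6) \<and>
    matrix_inv (dual_fisher \<xi>) =
      vector [vector [\<sigma>\<^sup>2, 2 * \<mu> * \<sigma>\<^sup>2], vector [2 * \<mu> * \<sigma>\<^sup>2, 2 * \<sigma> ^ 4 + 4 * \<mu>\<^sup>2 * \<sigma>\<^sup>2]]"
proof (intro conjI)
  have \<xi>: "\<xi> $ 1 = \<mu>" "\<xi> $ 2 = \<mu>\<^sup>2 + \<sigma>\<^sup>2"
    using assms(2) by (simp_all add: dual_coord_def)
  have less: "\<xi> $ 2 > (\<xi> $ 1)\<^sup>2" and sq: "sqrt (\<xi> $ 2 - (\<xi> $ 1)\<^sup>2) = \<sigma>"
    using assms(1) by (simp_all add: \<xi>)
  have nat: "natural_coord \<xi> = vector [\<mu>, \<sigma>]"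
    by (simp only: natural_coord_eq[OF less] sq) (simp add: \<xi>)
  have "vector [\<mu>, \<sigma>] \<in> Theta" using assms(1) by (simp add: Theta_def)
  note F = fisher_eq[OF this]
  note B = dual_basis_vector_eq[OF less, unfolded sq, unfolded \<xi>(1)]
  \<comment> \<open>With Fisher matrix diag(1/\<sigma>^2, 2/\<sigma>^2) the entries are 1/\<sigma>^2
    + 2\<mu>^2/\<sigma>^4, -\<mu>/\<sigma>^4 and 1/(2\<sigma>^4).\<close>
  show G: "dual_fisher \<xi> = (1 / \<sigma> ^ 4) *\<^sub>R vector [vector [\<sigma>\<^sup>2 + 2 * \<mu>\<^sup>2, - \<mu>], vector [- \<mu>, 1 / 2]]"
    using assms(1)
    by (simp add: vec_eq_iff forall_2 dual_fisher_def fisher_metric_def sum_2 nat F B)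
      (simp add: eval_nat_numeral field_simps)
  \<comment> \<open>The \<mu>^2 terms cancel, leaving (\<sigma>^2/2)/\<sigma>^8.\<close>
  show "det (dual_fisher \<xi>) = 1 / (2 * \<sigma> ^ 6)"
    using assms(1) unfolding G det_2
    by (simp add: field_simps) (simp add: eval_nat_numeral algebra_simps)
  show "matrix_inv (dual_fisher \<xi>) =
      vector [vector [\<sigma>\<^sup>2, 2 * \<mu> * \<sigma>\<^sup>2], vector [2 * \<mu> * \<sigma>\<^sup>2, 2 * \<sigma> ^ 4 + 4 * \<mu>\<^sup>2 * \<sigma>\<^sup>2]]"
    \<comment> \<open>It suffices to multiply \<open>G\<close> by the claimed inverse and compare
      the four entries with the identity.\<close>
    using assms(1)
    by (intro matrix_inv_unique, unfold G)
      (simp add: vec_eq_iff forall_2 matrix_matrix_mult_def sum_2 mat_def,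
       simp add: eval_nat_numeral field_simps)
qed

end
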